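(* Let $(\mathbf S,\mathcal A,\to)$ be a PTS. For all processes $s,t\in\mathbf S$ and every $k\in\mathbb N$, if $t\models\varphi_s^k$ then $s\sqsubseteq_k t$. Moreover, if $s$ is finite, then $t\models\varphi_s$ implies $s\sqsubseteq t$.
   Context: A PTS is a triple $(\mathbf S,\mathcal A,\to)$ with $\mathbf S$ a countable set of processes, $\mathcal A$ a countable set of actions and $\to\subseteq\mathbf S\times\mathcal A\times\Delta(\mathbf S)$, where $\Delta(\mathbf S)$ is the set of probability distributions on $\mathbf S$ with finite support. Write $s\xrightarrow{a}\pi$ for $(s,a,\pi)\in\to$; $\mathrm{init}(s)=\{a\mid\exists\pi.\ s\xrightarrow a\pi\}$; $\mathrm{der}(s,a)=\{\pi\mid s\xrightarrow a\pi\}$; $\mathrm{supp}(\pi)=\{t\mid\pi(t)>0\}$; $\delta_s$ is the Dirac distribution. The depth of $s$ is $0$ if $\mathrm{init}(s)=\emptyset$, otherwise $1+\sup\{\mathrm{depth}(t)\mid a\in\mathrm{init}(s),\pi\in\mathrm{der}(s,a),t\in\mathrm{supp}(\pi)\}$. A process is finite if $\mathrm{der}(s,a)$ is finite for all $a$ and its depth is finite. Lifting: for $R\subseteq\mathbf S\times\mathbf S$, $\pi R^\dagger\pi'$ iff there are an index set $I$, weights $p_i$ and $s_i,t_i$ with $\pi=\sum_ip_i\delta_{s_i}$, $\pi'=\sum_ip_i\delta_{t_i}$, $s_iRt_i$ for all $i$. A probabilistic simulation is $R$ such that $sRt$ and $s\xrightarrow a\pi_s$ imply $t\xrightarrow a\pi_t$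 for some $\pi_t$ with $\pi_sR^\dagger\pi_t$; $\sqsubseteq$ is the union of all probabilistic simulations. Up-to-$k$ simulations: $\sqsubseteq_0=\mathbf S\times\mathbf S$; $s\sqsubseteq_{k+1}t$ iff whenever $s\xrightarrow a\pi_s$ there is $t\xrightarrow a\pi_t$ with $\pi_s\sqsubseteq_k^\dagger\pi_t$. Logic and satisfaction: state formulae $\varphi::=\top\mid\neg\varphi\mid\bigwedge_{j\in J}\varphi_j\mid\langle a\rangle\psi$ ($J\ne\emptyset$ at most countable), distribution formulae $\psi::=\bigoplus_{i\in I}r_i\varphi_i$ ($I$ finite nonempty, $r_i\in(0,1]$, $\sum r_i=1$); $s\models\top$ always; $s\models\neg\varphi$ iff not $s\models\varphi$; $s\models\bigwedge_j\varphi_j$ iff $s\models\varphi_j$ for all $j$; $s\models\langle a\rangle\psi$ iff $s\xrightarrow a\pi$ for some $\pi\models\psi$; $\pi\models\bigoplus_ir_i\varphi_i$ iff $\pi=\sum_ir_i\pi_i$ for some $\pi_i\in\Delta(\mathbf S)$ with $u\models\varphi_i$ for all $u\in\mathrm{supp}(\pi_i)$. Write $\langle a\rangle\varphi$ for $\langle a\rangle(1\varphi)$. Mimicking formulae: $\varphi_s^0=\top$; for $k\ge1$, $\varphi_s^k=\bigwedge_{(s,a,\pi)\in\to}\langle a\rangle\psi_\pi^{k-1}\wedge\bigwedge_{b\notin\mathrm{init}(s)}\neg\langle b\rangle\top$ with $\psi_\pi^k=\bigoplus_{u\in\mathrm{supp}(\pi)}\pi(u)\varphi_u^k$. For finite $s$,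 $\varphi_s=\varphi_s^{\mathrm{depth}(s)+1}$. *)

theory Defs
  imports "HOL-Probability.Probability" "HOL-Library.Extended_Nat"
begin

section \<open>Probabilistic transition systems\<close>

record ('s, 'a) pts =
  procs :: "'s set"
  acts :: "'a set"
  steps :: "('s \<times> 'a \<times> 's pmf) set"

definition fin_dists :: "'s set \<Rightarrow> 's pmf set" where
  "fin_dists S = {\<pi>. finite (set_pmf \<pi>) \<and> set_pmf \<pi> \<subseteq> S}"

definition is_pts :: "('s, 'a) pts \<Rightarrow> bool" where
  "is_pts M \<longleftrightarrow> countable (procs M) \<and> countable (acts M) \<and>
     steps M \<subseteq> procs M \<times> acts M \<times> fin_dists (procs M)"

definition init :: "('s, 'a) pts \<Rightarrow> 's \<Rightarrow> 'a set" where
  "init M s = {a. \<exists>\<pi>. (s, a, \<pi>) \<in> steps M}"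

definition der :: "('s, 'a) pts \<Rightarrow> 's \<Rightarrow> 'a \<Rightarrow> 's pmf set" where
  "der M s a = {\<pi>. (s, a, \<pi>) \<in> steps M}"

definition depth_step :: "('s, 'a) pts \<Rightarrow> ('s \<Rightarrow> enat) \<Rightarrow> 's \<Rightarrow> enat" where
  "depth_step M d s =
     (if init M s = {} then 0
      else 1 + Sup {d t | a \<pi> t. a \<in> init M s \<and> \<pi> \<in> der M s a \<and> t \<in> set_pmf \<pi>})"

text \<open>The recursive description of the depth is not well-founded in general, but over
  the extended naturals it has exactly one solution; see \<open>depth_unfold\<close> and
  \<open>depth_unique\<close> below.\<close>

definition depth :: "('s, 'a) pts \<Rightarrow> 's \<Rightarrow> enat" where
  "depth M = lfp (depth_step M)"

lemma mono_depth_step: "mono (depth_step M)"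
proof (rule monoI, rule le_funI)
  fix d e :: "'a \<Rightarrow> enat" and s
  assume "d \<le> e"
  then have le: "d t \<le> e t" for t by (simp add: le_fun_def)
  have "Sup {d t | a \<pi> t. a \<in> init M s \<and> \<pi> \<in> der M s a \<and> t \<in> set_pmf \<pi>}
      \<le> Sup {e t | a \<pi> t. a \<in> init M s \<and> \<pi> \<in> der M s a \<and> t \<in> set_pmf \<pi>}"
  proof (rule Complete_Lattices.Sup_mono)
    fix x assume "x \<in> {d t | a \<pi> t. a \<in> init M s \<and> \<pi> \<in> der M s a \<and> t \<in> set_pmf \<pi>}"
    then obtain a \<pi> t where "x = d t" "a \<in> init M s" "\<pi> \<in> der M s a" "t \<in> set_pmf \<pi>"
      by blast
    then show "\<exists>y\<in>{e t | a \<pi> t. a \<in> init M s \<and> \<pi> \<in> der M s a \<and> t \<in> set_pmf \<pi>}. x \<le> y"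
      using le[of t] by (intro bexI[of _ "e t"]) auto
  qed
  then show "depth_step M d s \<le> depth_step M e s"
    by (auto simp: depth_step_def intro: add_left_mono)
qed

lemma depth_unfold:
  "depth M s =
     (if init M s = {} then 0
      else 1 + Sup {depth M t | a \<pi> t. a \<in> init M s \<and> \<pi> \<in> der M s a \<and> t \<in> set_pmf \<pi>})"
proof -
  have "depth M = depth_step M (depth M)"
    unfolding depth_def by (rule lfp_unfold[OF mono_depth_step])
  then have "depth M s = depth_step M (depth M) s" by (rule fun_cong)
  then show ?thesis by (simp only: depth_step_def)
qed

lemma depth_step_solutions_le:
  assumes d: "\<And>s. d s = depth_step M d s" and e: "\<And>s. e s = depth_step M e s"
  shows "enat n \<le> d s \<Longrightarrow> enat n \<le> e s"
proof (induction n arbitrary: s)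
  case 0
  then show ?case by (simp flip: zero_enat_def)
next
  case (Suc n)
  let ?T = "{t. \<exists>a \<pi>. a \<in> init M s \<and> \<pi> \<in> der M s a \<and> t \<in> set_pmf \<pi>}"
  have eq: "{f t | a \<pi> t. a \<in> init M s \<and> \<pi> \<in> der M s a \<and> t \<in> set_pmf \<pi>} = f ` ?T"
    for f :: "'a \<Rightarrow> enat" by blast
  have ne: "init M s \<noteq> {}"
    using Suc.prems d[of s] by (auto simp: depth_step_def zero_enat_def)
  have ds: "d s = 1 + Sup (d ` ?T)" and es: "e s = 1 + Sup (e ` ?T)"
    using d[of s] e[of s] ne by (simp_all add: depth_step_def eq)
  have "enat n \<le> Sup (d ` ?T)"
    using Suc.prems ds by (cases "Sup (d ` ?T)") (auto simp: one_enat_def)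
  have "enat n \<le> Sup (e ` ?T)"
  proof (cases n)
    case 0
    then show ?thesis by (simp flip: zero_enat_def)
  next
    fix m assume m: "n = Suc m"
    have "\<exists>t\<in>?T. enat n \<le> d t"
    proof (rule ccontr)
      assume none: "\<not> (\<exists>t\<in>?T. enat n \<le> d t)"
      have "d t \<le> enat m" if "t \<in> ?T" for t
      proof -
        have "\<not> enat n \<le> d t" using none that by blast
        then show ?thesis unfolding m by (cases "d t") auto
      qed
      then have "Sup (d ` ?T) \<le> enat m" by (rule SUP_least)
      with \<open>enat n \<le> Sup (d ` ?T)\<close> have "enat n \<le> enat m" by (rule order_trans)
      with m show False by simp
    qed
    then obtain t where t: "t \<in> ?T" "enat n \<le> d t" by (rule bexE)
    from t(2) have "enat n \<le> e t" by (rule Suc.IH)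
    also have "e t \<le> Sup (e ` ?T)" using t(1) by (rule SUP_upper)
    finally show ?thesis .
  qed
  then show ?case
    using es by (cases "Sup (e ` ?T)") (auto simp: one_enat_def)
qed

lemma depth_unique:
  assumes "\<And>s. d s =
     (if init M s = {} then 0
      else 1 + Sup {d t | a \<pi> t. a \<in> init M s \<and> \<pi> \<in> der M s a \<and> t \<in> set_pmf \<pi>})"
  shows "d = depth M"
proof (rule ext, rule antisym)
  fix s
  have d: "d s = depth_step M d s" for s unfolding depth_step_def by (rule assms)
  have e: "depth M s = depth_step M (depth M) s" for s
    unfolding depth_step_def by (rule depth_unfold)
  have le: "x \<le> y" if "\<And>n. enat n \<le> x \<Longrightarrow> enat n \<le> y" for x y :: enat
  proof (cases x)
    case (enat n)
    then show ?thesis using that by simp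
  next
    case infinity
    have "y = \<infinity>"
    proof (cases y)
      case (enat n)
      then show ?thesis using that[of "Suc n"] infinity by simp
    qed
    then show ?thesis by simp
  qed
  show "d s \<le> depth M s" by (rule le) (rule depth_step_solutions_le[OF d e])
  show "depth M s \<le> d s" by (rule le) (rule depth_step_solutions_le[OF e d])
qed

definition finite_process :: "('s, 'a) pts \<Rightarrow> 's \<Rightarrow> bool" where
  "finite_process M s \<longleftrightarrow> (\<forall>a\<in>acts M. finite (der M s a)) \<and> depth M s \<noteq> \<infinity>"

section \<open>Probabilistic simulations\<close>

text \<open>Distributions have finite support, so the index sets of the decompositions are
  finite; up to renaming they are finite sets of natural numbers.\<close>

definition lifting :: "('s \<times> 's) set \<Rightarrow> 's pmf \<Rightarrow> 's pmf \<Rightarrow> bool" where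
  "lifting R \<pi> \<pi>' \<longleftrightarrow>
     (\<exists>(I :: nat set) (p :: nat \<Rightarrow> real) s t.
        finite I \<and> (\<forall>i\<in>I. 0 < p i \<and> p i \<le> 1) \<and> (\<Sum>i\<in>I. p i) = 1 \<and>
        (\<forall>x. pmf \<pi> x = (\<Sum>i\<in>I. p i * pmf (return_pmf (s i)) x)) \<and>
        (\<forall>x. pmf \<pi>' x = (\<Sum>i\<in>I. p i * pmf (return_pmf (t i)) x)) \<and>
        (\<forall>i\<in>I. (s i, t i) \<in> R))"

definition prob_simulation :: "('s, 'a) pts \<Rightarrow> ('s \<times> 's) set \<Rightarrow> bool" where
  "prob_simulation M R \<longleftrightarrow> R \<subseteq> procs M \<times> procs M \<and>
     (\<forall>s t a \<pi>\<^sub>s. (s, t) \<in> R \<and> (s, a, \<pi>\<^sub>s) \<in> steps M \<longrightarrow>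
        (\<exists>\<pi>\<^sub>t. (t, a, \<pi>\<^sub>t) \<in> steps M \<and> lifting R \<pi>\<^sub>s \<pi>\<^sub>t))"

definition similarity :: "('s, 'a) pts \<Rightarrow> ('s \<times> 's) set" where
  "similarity M = \<Union>{R. prob_simulation M R}"

primrec simulation_upto :: "('s, 'a) pts \<Rightarrow> nat \<Rightarrow> ('s \<times> 's) set" where
  "simulation_upto M 0 = procs M \<times> procs M"
| "simulation_upto M (Suc k) =
     {(s, t) \<in> procs M \<times> procs M.
        \<forall>a \<pi>\<^sub>s. (s, a, \<pi>\<^sub>s) \<in> steps M \<longrightarrow>
          (\<exists>\<pi>\<^sub>t. (t, a, \<pi>\<^sub>t) \<in> steps M \<and> lifting (simulation_upto M k) \<pi>\<^sub>s \<pi>\<^sub>t)}"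

section \<open>The modal logic\<close>

text \<open>The datatypes contain the formulae of the logic and also degenerate ones (uncountable
  conjunctions, mixtures whose weights do not sum to one). The formulae of the logic are
  singled out by \<open>state_formula\<close> and \<open>dist_formula\<close>. Indexed families are
  given by an index set and a function on the index type, whose values outside the index
  set are irrelevant; \<open>'i\<close> and \<open>'j\<close> are the index types of conjunctions and
  mixtures.\<close>

datatype ('a, 'i, 'j) sform =
    Top
  | Neg "('a, 'i, 'j) sform"
  | Conj "'i set" "'i \<Rightarrow> ('a, 'i, 'j) sform"
  | Diam 'a "('a, 'i, 'j) dform"
and ('a, 'i, 'j) dform =
    Mix "'j set" "'j \<Rightarrow> real" "'j \<Rightarrow> ('a, 'i, 'j) sform"

primrec state_formula :: "'a set \<Rightarrow> ('a, 'i, 'j) sform \<Rightarrow> bool"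
  and dist_formula :: "'a set \<Rightarrow> ('a, 'i, 'j) dform \<Rightarrow> bool" where
  "state_formula A Top \<longleftrightarrow> True"
| "state_formula A (Neg \<phi>) \<longleftrightarrow> state_formula A \<phi>"
| "state_formula A (Conj J \<phi>) \<longleftrightarrow>
     J \<noteq> {} \<and> countable J \<and> (\<forall>j\<in>J. state_formula A (\<phi> j))"
| "state_formula A (Diam a \<psi>) \<longleftrightarrow> a \<in> A \<and> dist_formula A \<psi>"
| "dist_formula A (Mix I r \<phi>) \<longleftrightarrow>
     finite I \<and> I \<noteq> {} \<and> (\<forall>i\<in>I. 0 < r i \<and> r i \<le> 1) \<and> (\<Sum>i\<in>I. r i) = 1 \<and>
     (\<forall>i\<in>I. state_formula A (\<phi> i))"

primrec sat :: "('s, 'a) pts \<Rightarrow> ('a, 'i, 'j) sform \<Rightarrow> 's \<Rightarrow> bool"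
  and dist_sat :: "('s, 'a) pts \<Rightarrow> ('a, 'i, 'j) dform \<Rightarrow> 's pmf \<Rightarrow> bool" where
  "sat M Top s \<longleftrightarrow> True"
| "sat M (Neg \<phi>) s \<longleftrightarrow> \<not> sat M \<phi> s"
| "sat M (Conj J \<phi>) s \<longleftrightarrow> (\<forall>j\<in>J. sat M (\<phi> j) s)"
| "sat M (Diam a \<psi>) s \<longleftrightarrow> (\<exists>\<pi>. (s, a, \<pi>) \<in> steps M \<and> dist_sat M \<psi> \<pi>)"
| "dist_sat M (Mix I r \<phi>) \<pi> \<longleftrightarrow>
     (\<exists>\<rho>. (\<forall>i\<in>I. \<rho> i \<in> fin_dists (procs M)) \<and>
          (\<forall>x. pmf \<pi> x = (\<Sum>i\<in>I. r i * pmf (\<rho> i) x)) \<and>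
          (\<forall>i\<in>I. \<forall>u\<in>set_pmf (\<rho> i). sat M (\<phi> i) u))"

text \<open>The mixture \<open>1\<phi>\<close>; the choice of its only index is immaterial.\<close>

definition pure :: "('a, 'i, 'j) sform \<Rightarrow> ('a, 'i, 'j) dform" where
  "pure \<phi> = Mix {undefined} (\<lambda>_. 1) (\<lambda>_. \<phi>)"

text \<open>Conjunctions in the logic have nonempty index sets; an empty conjunction arising in
  a mimicking formula is read as \<open>\<top>\<close>.\<close>

definition conj_family :: "'i set \<Rightarrow> ('i \<Rightarrow> ('a, 'i, 'j) sform) \<Rightarrow> ('a, 'i, 'j) sform" where
  "conj_family J \<phi> = (if J = {} then Top else Conj J \<phi>)"

section \<open>Mimicking formulae\<close>

definition dist_of :: "'s pmf \<Rightarrow> ('s \<Rightarrow> ('a, 'i, 's) sform) \<Rightarrow> ('a, 'i, 's) dform" where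
  "dist_of \<pi> \<phi> = Mix (set_pmf \<pi>) (pmf \<pi>) \<phi>"

text \<open>The two families of conjuncts, one per transition of \<open>s\<close> and one per action
  outside \<open>init M s\<close>, are joined in one conjunction over the disjoint union of
  their index sets.\<close>

primrec mimicking ::
  "('s, 'a) pts \<Rightarrow> nat \<Rightarrow> 's \<Rightarrow> ('a, 'a \<times> 's pmf + 'a, 's) sform" where
  "mimicking M 0 = (\<lambda>s. Top)"
| "mimicking M (Suc k) = (\<lambda>s.
     conj_family
       ({(a, \<pi>). (s, a, \<pi>) \<in> steps M} <+> (acts M - init M s))
       (case_sum (\<lambda>(a, \<pi>). Diam a (dist_of \<pi> (mimicking M k)))
                 (\<lambda>b. Neg (Diam b (pure Top)))))"

text \<open>Used for finite \<open>s\<close> only.\<close>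

definition mimicking_finite ::
  "('s, 'a) pts \<Rightarrow> 's \<Rightarrow> ('a, 'a \<times> 's pmf + 'a, 's) sform" where
  "mimicking_finite M s = mimicking M (the_enat (depth M s) + 1) s"

text \<open>A process of an arbitrary PTS may have uncountably many transitions, as
  \<open>fin_dists (procs M)\<close> is uncountable. Its mimicking formulae are then
  conjunctions of the same shape, but outside the logic. With countably many transitions
  they belong to the logic.\<close>

lemma state_formula_mimicking:
  assumes M: "is_pts M" and "countable (steps M)"
  shows "state_formula (acts M) (mimicking M k s)"
proof (induction k arbitrary: s)
  case 0
  show ?case by simp
next
  case (Suc k)
  let ?T = "{(a, \<pi>). (s, a, \<pi>) \<in> steps M}"
  have "?T \<subseteq> snd ` steps M"
  proof
    fix x assume "x \<in> ?T"
    then have "(s, x) \<in> steps M" by (cases x) simp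
    then have "snd (s, x) \<in> snd ` steps M" by (rule imageI)
    then show "x \<in> snd ` steps M" by simp
  qed
  then have T: "countable ?T" by (rule countable_subset) (rule countable_image[OF assms(2)])
  have A: "countable (acts M - init M s)" using M by (auto simp: is_pts_def)
  have step: "a \<in> acts M" "finite (set_pmf \<pi>)" if "(s, a, \<pi>) \<in> steps M" for a \<pi>
    using that M by (auto simp: is_pts_def fin_dists_def)
  have "dist_formula (acts M) (dist_of \<pi> (mimicking M k))" if "(s, a, \<pi>) \<in> steps M" for a \<pi>
    using step(2)[OF that] Suc.IH
    by (auto simp: dist_of_def pmf_le_1 set_pmf_not_empty pmf_positive sum_pmf_eq_1)
  then have "state_formula (acts M)
      (case_sum (\<lambda>(a, \<pi>). Diam a (dist_of \<pi> (mimicking M k))) (\<lambda>b. Neg (Diam b (pure Top))) j)"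
    if "j \<in> ?T <+> (acts M - init M s)" for j
    using that step(1) by (cases j) (auto simp: pure_def)
  moreover have "countable (?T <+> (acts M - init M s))"
    unfolding Plus_def by (intro countable_Un countable_image T A)
  ultimately show ?case
    by (simp add: conj_family_def)
qed

end

theory Submission imports Defs begin

text \<open>A decomposition \<open>\<pi>' = (\<Sum>u. \<pi>(u) \<rho>\<^sub>u)\<close> witnessing \<open>\<pi>' \<Turnstile> \<psi>\<^sub>\<pi>\<^sup>k\<close> is the same thing as
  the coupling \<open>(u, v) \<mapsto> \<pi>(u) \<rho>\<^sub>u(v)\<close> of \<open>\<pi>\<close> and \<open>\<pi>'\<close>, which gives the first claim by
  induction on \<open>k\<close>. For the second claim, depth strictly decreases along transitions, so the
  pairs \<open>(s, t)\<close> such that \<open>s \<sqsubseteq>\<^sub>k t\<close> for some \<open>k\<close> that is at least the depth of \<open>s\<close> form a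
  probabilistic simulation.\<close>

lemma pmf_bind_finite:
  assumes "finite (set_pmf \<pi>)"
  shows "pmf (bind_pmf \<pi> f) x = (\<Sum>u\<in>set_pmf \<pi>. pmf \<pi> u * pmf (f u) x)"
  using assms by (simp add: pmf_bind integral_measure_pmf_real[of "set_pmf \<pi>"] mult.commute)

text \<open>The points of the support of \<open>\<omega>\<close> serve as indices: the pair
  \<open>(u, v)\<close> gets the weight \<open>pmf \<omega> (u, v)\<close>. The bijection
  \<open>h\<close> only renames them to naturals, the index type of \<open>lifting\<close>.\<close>

lemma lifting_coupling:
  assumes fin: "finite (set_pmf \<omega>)" and R: "set_pmf \<omega> \<subseteq> R"
  shows "lifting R (map_pmf fst \<omega>) (map_pmf snd \<omega>)"
proof -
  obtain h where h: "bij_betw h {0..<card (set_pmf \<omega>)} (set_pmf \<omega>)"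
    using ex_bij_betw_nat_finite[OF fin] by blast
  let ?I = "{0..<card (set_pmf \<omega>)}"
  have in_supp: "h i \<in> set_pmf \<omega>" if "i \<in> ?I" for i
    using h that by (rule bij_betwE[rule_format])
  have "(\<Sum>i\<in>?I. pmf \<omega> (h i)) = 1"
    using sum.reindex_bij_betw[OF h, of "pmf \<omega>"] sum_pmf_eq_1[OF fin subset_refl] by simp
  \<comment> \<open>Generic in \<open>f\<close>, so that \<open>fst\<close> and \<open>snd\<close>
    give both marginals.\<close>
  moreover have "pmf (map_pmf f \<omega>) x = (\<Sum>i\<in>?I. pmf \<omega> (h i) * pmf (return_pmf (f (h i))) x)"
    for f :: "_ \<Rightarrow> 'a" and x
    using sum.reindex_bij_betw[OF h, of "\<lambda>z. pmf \<omega> z * pmf (return_pmf (f z)) x"]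
    by (simp add: map_pmf_def pmf_bind_finite[OF fin])
  ultimately show ?thesis
    unfolding lifting_def using in_supp R
    by (intro exI[of _ ?I] exI[of _ "\<lambda>i. pmf \<omega> (h i)"] exI[of _ "\<lambda>i. fst (h i)"]
        exI[of _ "\<lambda>i. snd (h i)"]) (auto simp: pmf_positive pmf_le_1)
qed

text \<open>Each \<open>s i\<close> carries positive weight in \<open>\<pi>\<close>, so it lies in
  the support. This allows adding to \<open>R\<close> facts known only for successors, such as a
  depth bound.\<close>

lemma lifting_mono_support:
  assumes "lifting R \<pi> \<pi>'" and R': "\<And>u v. u \<in> set_pmf \<pi> \<Longrightarrow> (u, v) \<in> R \<Longrightarrow> (u, v) \<in> R'"
  shows "lifting R' \<pi> \<pi>'"
proof -
  obtain I :: "nat set" and p s t where I: "finite I" "\<forall>i\<in>I. 0 < p i \<and> p i \<le> 1" "sum p I = 1"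
    and \<pi>: "\<forall>x. pmf \<pi> x = (\<Sum>i\<in>I. p i * pmf (return_pmf (s i)) x)"
    and \<pi>': "\<forall>x. pmf \<pi>' x = (\<Sum>i\<in>I. p i * pmf (return_pmf (t i)) x)"
    and R: "\<forall>i\<in>I. (s i, t i) \<in> R"
    using assms(1) unfolding lifting_def by blast
  have "s i \<in> set_pmf \<pi>" if "i \<in> I" for i
  proof -
    have "0 < p i * pmf (return_pmf (s i)) (s i)" using I that by simp
    also have "\<dots> \<le> (\<Sum>j\<in>I. p j * pmf (return_pmf (s j)) (s i))"
      using I that by (intro member_le_sum[of i I "\<lambda>j. p j * pmf (return_pmf (s j)) (s i)"])
        (auto simp: less_imp_le)
    finally show ?thesis using \<pi> by (simp add: set_pmf_iff)
  qed
  then have "\<forall>i\<in>I. (s i, t i) \<in> R'" using R R' by blast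
  then show ?thesis unfolding lifting_def using I \<pi> \<pi>' by blast
qed

lemma lifting_of_dist_sat:
  assumes fin: "finite (set_pmf \<pi>)" and sat: "dist_sat M (dist_of \<pi> \<phi>) \<pi>'"
    and R: "\<And>u v. u \<in> set_pmf \<pi> \<Longrightarrow> v \<in> procs M \<Longrightarrow> sat M (\<phi> u) v \<Longrightarrow> (u, v) \<in> R"
  shows "lifting R \<pi> \<pi>'"
proof -
  obtain \<rho> where \<rho>: "\<forall>u\<in>set_pmf \<pi>. \<rho> u \<in> fin_dists (procs M)"
    and \<pi>': "\<forall>x. pmf \<pi>' x = (\<Sum>u\<in>set_pmf \<pi>. pmf \<pi> u * pmf (\<rho> u) x)"
    and sat_\<rho>: "\<forall>u\<in>set_pmf \<pi>. \<forall>v\<in>set_pmf (\<rho> u). sat M (\<phi> u) v"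
    using sat by (auto simp: dist_of_def)
  \<comment> \<open>Draw \<open>u\<close> from \<open>\<pi>\<close>, then \<open>v\<close> from
    \<open>\<rho> u\<close>; the second marginal is the mixture defining
    \<open>\<pi>'\<close>.\<close>
  define \<omega> where "\<omega> = bind_pmf \<pi> (\<lambda>u. map_pmf (Pair u) (\<rho> u))"
  have "map_pmf fst \<omega> = \<pi>"
    by (simp add: \<omega>_def map_bind_pmf pmf.map_comp o_def bind_return_pmf')
  moreover have "map_pmf snd \<omega> = \<pi>'"
    by (rule pmf_eqI) (simp add: \<omega>_def map_bind_pmf pmf.map_comp o_def pmf_bind_finite[OF fin] \<pi>')
  moreover have "finite (set_pmf \<omega>)"
    using fin \<rho> by (auto simp: \<omega>_def fin_dists_def)
  moreover have "set_pmf \<omega> \<subseteq> R"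
    using \<rho> sat_\<rho> R by (fastforce simp: \<omega>_def fin_dists_def)
  ultimately show ?thesis using lifting_coupling by metis
qed

lemma sat_conj_family: "sat M (conj_family J \<phi>) s \<longleftrightarrow> (\<forall>j\<in>J. sat M (\<phi> j) s)"
  by (simp add: conj_family_def)

lemma simulation_upto_of_sat_mimicking:
  assumes M: "is_pts M"
  shows "s \<in> procs M \<Longrightarrow> t \<in> procs M \<Longrightarrow> sat M (mimicking M k s) t \<Longrightarrow>
    (s, t) \<in> simulation_upto M k"
proof (induction k arbitrary: s t)
  case 0
  then show ?case by simp
next
  case (Suc k)
  have "\<exists>\<pi>\<^sub>t. (t, a, \<pi>\<^sub>t) \<in> steps M \<and> lifting (simulation_upto M k) \<pi> \<pi>\<^sub>t"
    if step: "(s, a, \<pi>) \<in> steps M" for a \<pi>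
  proof -
    \<comment> \<open>The conjunct with index \<open>Inl (a, \<pi>)\<close>, the one belonging to
      the given transition.\<close>
    have "sat M (Diam a (dist_of \<pi> (mimicking M k))) t"
      using Suc.prems(3) step
      by (auto simp: sat_conj_family dest!: bspec[of _ _ "Inl (a, \<pi>)"])
    then obtain \<pi>\<^sub>t where \<pi>\<^sub>t: "(t, a, \<pi>\<^sub>t) \<in> steps M" "dist_sat M (dist_of \<pi> (mimicking M k)) \<pi>\<^sub>t"
      by auto
    have "finite (set_pmf \<pi>)" "set_pmf \<pi> \<subseteq> procs M"
      using M step by (auto simp: is_pts_def fin_dists_def)
    then have "lifting (simulation_upto M k) \<pi> \<pi>\<^sub>t"
      using \<pi>\<^sub>t(2) Suc.IH by (blast intro: lifting_of_dist_sat)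
    with \<pi>\<^sub>t(1) show ?thesis by blast
  qed
  with Suc.prems show ?case by simp
qed

lemma depth_successor:
  assumes "(s, a, \<pi>) \<in> steps M" "u \<in> set_pmf \<pi>"
  shows "1 + depth M u \<le> depth M s"
proof -
  have "init M s \<noteq> {}" using assms by (auto simp: init_def)
  moreover have "depth M u
    \<le> Sup {depth M t | a \<pi> t. a \<in> init M s \<and> \<pi> \<in> der M s a \<and> t \<in> set_pmf \<pi>}"
    using assms by (intro Sup_upper) (auto simp: init_def der_def)
  ultimately show ?thesis
    by (subst (2) depth_unfold) (simp add: add_left_mono)
qed

lemma simulation_upto_subset: "simulation_upto M k \<subseteq> procs M \<times> procs M"
  by (cases k) auto

text \<open>A step lowers the depth by at least one, so the bound survives passing from level
  \<open>k\<close> to \<open>k - 1\<close>. Level 0 relates all processes, but there the bound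
  forces depth 0, which excludes transitions from \<open>s\<close>.\<close>

lemma prob_simulation_upto_depth:
  "prob_simulation M {(s, t). \<exists>k. depth M s \<le> enat k \<and> (s, t) \<in> simulation_upto M k}"
  (is "prob_simulation M ?R")
proof -
  have "\<exists>\<pi>\<^sub>t. (t, a, \<pi>\<^sub>t) \<in> steps M \<and> lifting ?R \<pi> \<pi>\<^sub>t"
    if st: "(s, t) \<in> ?R" and step: "(s, a, \<pi>) \<in> steps M" for s t a \<pi>
  proof -
    obtain k where k: "depth M s \<le> enat k" "(s, t) \<in> simulation_upto M k"
      using st by blast
    have succ: "1 + depth M u \<le> enat k" if "u \<in> set_pmf \<pi>" for u
      using depth_successor[OF step that] k(1) by (rule order_trans)
    \<comment> \<open>The support is nonempty, and any successor \<open>u\<close> gives 1 + depth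
      \<le> k, hence k > 0.\<close>
    obtain u where "u \<in> set_pmf \<pi>" using set_pmf_not_empty by fast
    from succ[OF this] obtain m where m: "k = Suc m"
      by (cases k; cases "depth M u") (auto simp: one_enat_def)
    obtain \<pi>\<^sub>t where "(t, a, \<pi>\<^sub>t) \<in> steps M" and lift: "lifting (simulation_upto M m) \<pi> \<pi>\<^sub>t"
      using k(2) step m by auto
    \<comment> \<open>The same \<open>m\<close> bounds the depth of every successor, as all pairs of
      the lifting come from one level.\<close>
    moreover have "depth M u \<le> enat m" if "u \<in> set_pmf \<pi>" for u
      using succ[OF that] m by (cases "depth M u") (auto simp: one_enat_def)
    then have "lifting ?R \<pi> \<pi>\<^sub>t"
      by (intro lifting_mono_support[OF lift]) blast
    ultimately show ?thesis by blast
  qed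
  moreover have "?R \<subseteq> procs M \<times> procs M" using simulation_upto_subset by fast
  ultimately show ?thesis unfolding prob_simulation_def by blast
qed

theorem theorem4:
  fixes M :: "('s, 'a) pts"
  assumes "is_pts M"
  shows "\<forall>s\<in>procs M. \<forall>t\<in>procs M.
           (\<forall>k. sat M (mimicking M k s) t \<longrightarrow> (s, t) \<in> simulation_upto M k) \<and>
           (finite_process M s \<longrightarrow> sat M (mimicking_finite M s) t \<longrightarrow> (s, t) \<in> similarity M)"
proof (intro ballI conjI allI impI)
  fix s t k
  assume st: "s \<in> procs M" "t \<in> procs M"
  show "(s, t) \<in> simulation_upto M k" if "sat M (mimicking M k s) t"
    using simulation_upto_of_sat_mimicking[OF assms st that] .
  assume "finite_process M s" and sat: "sat M (mimicking_finite M s) t"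
  then obtain n where n: "depth M s = enat n" by (auto simp: finite_process_def)
  \<comment> \<open>As the depth is finite, \<open>the_enat\<close> returns \<open>n\<close>, and
    \<open>mimicking_finite\<close> is the formula of level \<open>n + 1\<close>.\<close>
  then have "(s, t) \<in> simulation_upto M (n + 1)"
    using simulation_upto_of_sat_mimicking[OF assms st, of "n + 1"] sat
    by (simp only: mimicking_finite_def the_enat.simps)
  moreover have "depth M s \<le> enat (n + 1)" using n by simp
  ultimately have "(s, t) \<in> {(s, t). \<exists>k. depth M s \<le> enat k \<and> (s, t) \<in> simulation_upto M k}"
    by blast
  then show "(s, t) \<in> similarity M"
    unfolding similarity_def using prob_simulation_upto_depth by blast
qed

end
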